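(* Let $t\ge1$ and let $G=G_1\boxplus^t G_2$ be the Dirac $t$-join of two disjoint non-empty graphs $G_1$ and $G_2$. Then $\chi_t(G)=\chi_t(G_1)+\chi_t(G_2)$, and $G$ is $\chi_t$-critical if and only if both $G_1$ and $G_2$ are $\chi_t$-critical.
   Context: All graphs are finite, undirected, loopless, and may have multiple edges. For disjoint graphs $G_1,G_2$, the Dirac $t$-join $G_1\boxplus^t G_2$ is obtained from $G_1\cup G_2$ by adding edges so that every $u\in V(G_1)$ and $v\in V(G_2)$ are joined by exactly $t$ parallel edges. A graph is strictly $t$-degenerate if every non-empty subgraph $H$ has a vertex of degree (with multiplicity) at most $t-1$ in $H$. $\chi_t(G)$ is the least $k\ge0$ such that $V(G)$ can be colored with $k$ colors so that each color class induces a strictly $t$-degenerate subgraph. $G$ is $\chi_t$-critical if $\chi_t(G')<\chi_t(G)$ for every proper subgraph $G'$. *)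

theory Defs
  imports Main
begin

text \<open>
  Multigraphs with individual edges: parallel edges are distinct elements of \<open>edges\<close> with the
  same set of ends.  The function \<open>ends\<close> is only meaningful on \<open>edges\<close>.  Requiring exactly
  two ends excludes loops.  The graph without vertices is allowed.
\<close>

record ('v, 'e) mgraph =
  verts :: "'v set"
  edges :: "'e set"
  ends  :: "'e \<Rightarrow> 'v set"

definition multigraph :: "('v, 'e) mgraph \<Rightarrow> bool" where
  "multigraph G \<longleftrightarrow> finite (verts G) \<and> finite (edges G) \<and>
     (\<forall>e\<in>edges G. ends G e \<subseteq> verts G \<and> card (ends G e) = 2)"

definition subgraph :: "('v, 'e) mgraph \<Rightarrow> ('v, 'e) mgraph \<Rightarrow> bool" where
  "subgraph H G \<longleftrightarrow> multigraph H \<and> verts H \<subseteq> verts G \<and> edges H \<subseteq> edges G \<and>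
     (\<forall>e\<in>edges H. ends H e = ends G e)"

text \<open>Not stated as \<open>H \<noteq> G\<close>: values of \<open>ends\<close> outside \<open>edges\<close> must not count.\<close>

definition proper_subgraph :: "('v, 'e) mgraph \<Rightarrow> ('v, 'e) mgraph \<Rightarrow> bool" where
  "proper_subgraph H G \<longleftrightarrow> subgraph H G \<and> (verts H \<noteq> verts G \<or> edges H \<noteq> edges G)"

definition induced_subgraph :: "('v, 'e) mgraph \<Rightarrow> 'v set \<Rightarrow> ('v, 'e) mgraph" where
  "induced_subgraph G X = \<lparr>verts = X, edges = {e \<in> edges G. ends G e \<subseteq> X}, ends = ends G\<rparr>"

definition degree :: "('v, 'e) mgraph \<Rightarrow> 'v \<Rightarrow> nat" where
  "degree G v = card {e \<in> edges G. v \<in> ends G e}"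

definition edges_between :: "('v, 'e) mgraph \<Rightarrow> 'v \<Rightarrow> 'v \<Rightarrow> 'e set" where
  "edges_between G u v = {e \<in> edges G. ends G e = {u, v}}"

definition disjoint_graphs :: "('v, 'e) mgraph \<Rightarrow> ('v, 'e) mgraph \<Rightarrow> bool" where
  "disjoint_graphs G1 G2 \<longleftrightarrow> verts G1 \<inter> verts G2 = {} \<and> edges G1 \<inter> edges G2 = {}"

text \<open>
  \<open>dirac_join t G1 G2 G\<close> says that \<open>G\<close> is a Dirac \<open>t\<close>-join of the disjoint graphs \<open>G1\<close> and
  \<open>G2\<close>.  This is a relation because the names of the added edges are arbitrary.
\<close>

definition dirac_join ::
    "nat \<Rightarrow> ('v, 'e) mgraph \<Rightarrow> ('v, 'e) mgraph \<Rightarrow> ('v, 'e) mgraph \<Rightarrow> bool" where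
  "dirac_join t G1 G2 G \<longleftrightarrow>
     multigraph G \<and> subgraph G1 G \<and> subgraph G2 G \<and>
     verts G = verts G1 \<union> verts G2 \<and>
     (\<forall>e \<in> edges G - (edges G1 \<union> edges G2).
        \<exists>u\<in>verts G1. \<exists>v\<in>verts G2. ends G e = {u, v}) \<and>
     (\<forall>u\<in>verts G1. \<forall>v\<in>verts G2. card (edges_between G u v) = t)"

text \<open>For \<open>t \<ge> 1\<close>, \<open>degree H v < t\<close> is \<open>degree H v \<le> t - 1\<close>.\<close>

definition strictly_degenerate :: "nat \<Rightarrow> ('v, 'e) mgraph \<Rightarrow> bool" where
  "strictly_degenerate t G \<longleftrightarrow>
     (\<forall>H. subgraph H G \<and> verts H \<noteq> {} \<longrightarrow> (\<exists>v\<in>verts H. degree H v < t))"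

definition degenerate_coloring :: "nat \<Rightarrow> ('v, 'e) mgraph \<Rightarrow> nat \<Rightarrow> ('v \<Rightarrow> nat) \<Rightarrow> bool" where
  "degenerate_coloring t G k c \<longleftrightarrow> (\<forall>v\<in>verts G. c v < k) \<and>
     (\<forall>i<k. strictly_degenerate t (induced_subgraph G {v \<in> verts G. c v = i}))"

definition chi :: "nat \<Rightarrow> ('v, 'e) mgraph \<Rightarrow> nat" where
  "chi t G = (LEAST k. \<exists>c. degenerate_coloring t G k c)"

definition chi_critical :: "nat \<Rightarrow> ('v, 'e) mgraph \<Rightarrow> bool" where
  "chi_critical t G \<longleftrightarrow> (\<forall>H. proper_subgraph H G \<longrightarrow> chi t H < chi t G)"

text \<open>Whenever edge names do not run out, Dirac joins exist.\<close>

lemma dirac_join_exists: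
  fixes G1 G2 :: "('v, 'e) mgraph"
  assumes inf: "infinite (UNIV :: 'e set)"
    and G1: "multigraph G1" and G2: "multigraph G2" and disj: "disjoint_graphs G1 G2"
  shows "\<exists>G. dirac_join t G1 G2 G"
proof -
  let ?P = "verts G1 \<times> verts G2 \<times> {..<t}"
  have finP: "finite ?P" using G1 G2 by (auto simp: multigraph_def)
  have "infinite (- (edges G1 \<union> edges G2))"
    using inf G1 G2 by (simp add: multigraph_def Compl_eq_Diff_UNIV)
  then obtain F where F: "finite F" "card F = card ?P" "F \<subseteq> - (edges G1 \<union> edges G2)"
    by (meson infinite_arbitrarily_large)
  then obtain f where f: "bij_betw f F ?P"
    using finP finite_same_card_bij by blast
  define g where "g e = (if e \<in> edges G1 then ends G1 e else if e \<in> edges G2 then ends G2 e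
    else {fst (f e), fst (snd (f e))})" for e
  define G where "G = \<lparr>verts = verts G1 \<union> verts G2, edges = edges G1 \<union> edges G2 \<union> F, ends = g\<rparr>"
  have fF: "fst (f e) \<in> verts G1" "fst (snd (f e)) \<in> verts G2" if "e \<in> F" for e
    using bij_betwE[OF f] that by force+
  have g1: "g e = ends G1 e" if "e \<in> edges G1" for e using that by (simp add: g_def)
  have g2: "g e = ends G2 e" if "e \<in> edges G2" for e
    using that disj by (auto simp: g_def disjoint_graphs_def)
  have gF: "g e = {fst (f e), fst (snd (f e))}" if "e \<in> F" for e
    using that F by (auto simp: g_def)
  have gF2: "g e \<subseteq> verts G1 \<union> verts G2 \<and> card (g e) = 2" if "e \<in> F" for e
  proof -
    have "fst (f e) \<noteq> fst (snd (f e))"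
      using fF[OF that] disj by (auto simp: disjoint_graphs_def)
    then show ?thesis using fF[OF that] by (simp add: gF[OF that])
  qed
  have mG: "multigraph G"
  proof -
    have "g e \<subseteq> verts G1 \<union> verts G2 \<and> card (g e) = 2"
      if "e \<in> edges G1 \<union> edges G2 \<union> F" for e
      using that G1 G2 gF2[of e] g1[of e] g2[of e] unfolding multigraph_def
      by (metis Un_iff le_supI1 le_supI2)
    then show ?thesis using G1 G2 F(1) by (simp add: multigraph_def G_def)
  qed
  have "card (edges_between G u v) = t" if u: "u \<in> verts G1" and v: "v \<in> verts G2" for u v
  proof -
    have "edges_between G u v = {e \<in> F. f e \<in> {u} \<times> {v} \<times> {..<t}}" (is "_ = ?R")
    proof (rule set_eqI)
      fix e
      have n1: "g e \<noteq> {u, v}" if "e \<in> edges G1"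
      proof -
        have "g e \<subseteq> verts G1" using that G1 by (simp add: g1 multigraph_def)
        then show ?thesis using v disj by (auto simp: disjoint_graphs_def)
      qed
      have n2: "g e \<noteq> {u, v}" if "e \<in> edges G2"
      proof -
        have "g e \<subseteq> verts G2" using that G2 by (simp add: g2 multigraph_def)
        then show ?thesis using u disj by (auto simp: disjoint_graphs_def)
      qed
      have "g e = {u, v} \<longleftrightarrow> f e \<in> {u} \<times> {v} \<times> {..<t}" if e: "e \<in> F"
      proof -
        have "f e \<in> ?P" using bij_betwE[OF f] e by blast
        then obtain a b i where abi: "f e = (a, b, i)" "a \<in> verts G1" "b \<in> verts G2" "i < t"
          by auto
        have "{a, b} = {u, v} \<longleftrightarrow> a = u \<and> b = v"
          using abi u v disj unfolding doubleton_eq_iff disjoint_graphs_def by blast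
        then show ?thesis using abi by (simp add: gF[OF e])
      qed
      moreover have "e \<in> edges_between G u v \<longleftrightarrow>
          (e \<in> edges G1 \<or> e \<in> edges G2 \<or> e \<in> F) \<and> g e = {u, v}"
        by (simp add: edges_between_def G_def)
      ultimately show "e \<in> edges_between G u v \<longleftrightarrow> e \<in> ?R"
        unfolding mem_Collect_eq using n1 n2 by argo
    qed
    moreover have "card ?R = card ({u} \<times> {v} \<times> {..<t})"
    proof (rule bij_betw_same_card, rule bij_betw_subset[OF f])
      have "f ` F = ?P" using f by (simp add: bij_betw_def)
      moreover have "{u} \<times> {v} \<times> {..<t} \<subseteq> ?P" using u v by blast
      moreover have "f ` {e \<in> F. f e \<in> S} = f ` F \<inter> S" for S by blast
      ultimately show "f ` ?R = {u} \<times> {v} \<times> {..<t}" by (simp only: Int_absorb1)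
    qed simp
    ultimately show ?thesis by (simp add: card_cartesian_product)
  qed
  moreover have "subgraph G1 G" "subgraph G2 G"
    using G1 G2 by (simp_all add: subgraph_def G_def g1 g2 le_supI1)
  moreover have "\<exists>u\<in>verts G1. \<exists>v\<in>verts G2. ends G e = {u, v}"
    if "e \<in> edges G - (edges G1 \<union> edges G2)" for e
  proof -
    have e: "e \<in> F" and "ends G e = g e" using that by (auto simp: G_def)
    then show ?thesis using fF[OF e] gF[OF e] by blast
  qed
  moreover have "verts G = verts G1 \<union> verts G2" by (simp add: G_def)
  ultimately have "dirac_join t G1 G2 G"
    using mG by (simp add: dirac_join_def)
  then show ?thesis ..
qed

end

theory Submission
  imports Defs
begin

text \<open>
  Two vertices joined by \<open>t\<close> parallel edges induce a subgraph of minimum degree \<open>t\<close>, so no colour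
  class of a join meets both sides; this gives additivity of \<open>chi\<close>.  If both sides are critical and
  a joining edge \<open>uv\<close> is deleted, then \<open>{u, v}\<close> becomes an admissible colour class, while each
  side minus its end of \<open>uv\<close> needs one colour less than before.
\<close>

section \<open>Subgraphs and induced subgraphs\<close>

lemma multigraph_edge:
  assumes "multigraph G" "e \<in> edges G"
  shows "ends G e \<subseteq> verts G" "card (ends G e) = 2"
  using assms by (simp_all add: multigraph_def)

lemma subgraph_trans: "subgraph A B \<Longrightarrow> subgraph B C \<Longrightarrow> subgraph A C"
  unfolding subgraph_def by (auto dest: subsetD)

lemma subgraph_multigraph: "subgraph A B \<Longrightarrow> multigraph A"
  by (simp add: subgraph_def)

lemma induced_subgraph_simps [simp]:
  "verts (induced_subgraph G X) = X"
  "edges (induced_subgraph G X) = {e \<in> edges G. ends G e \<subseteq> X}"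
  "ends (induced_subgraph G X) = ends G"
  by (simp_all add: induced_subgraph_def)

lemma multigraph_induced:
  assumes "multigraph G" "X \<subseteq> verts G"
  shows "multigraph (induced_subgraph G X)"
  using assms by (auto simp: multigraph_def finite_subset)

lemma subgraph_induced:
  assumes "multigraph G" "X \<subseteq> verts G"
  shows "subgraph (induced_subgraph G X) G"
  using assms multigraph_induced[OF assms] by (auto simp: subgraph_def)

lemma subgraph_inducedI:
  assumes "subgraph H G" "verts H \<subseteq> X"
  shows "subgraph H (induced_subgraph G X)"
  using assms multigraph_edge[of H] by (fastforce simp: subgraph_def)

lemma induced_subgraph_mono:
  assumes "subgraph H G" "X \<subseteq> verts H" "X \<subseteq> Y"
  shows "subgraph (induced_subgraph H X) (induced_subgraph G Y)"
  using assms by (intro subgraph_inducedI subgraph_trans[OF subgraph_induced])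
    (auto simp: subgraph_multigraph)

text \<open>This is a genuine equality of records because \<open>induced_subgraph\<close> copies
  \<open>ends\<close> unchanged, even off the edge set.\<close>

lemma induced_subgraph_verts:
  fixes G :: "('v, 'e) mgraph"
  assumes "multigraph G"
  shows "induced_subgraph G (verts G) = G"
  using assms by (cases G) (auto simp: induced_subgraph_def multigraph_def)

section \<open>Strict degeneracy\<close>

lemma strictly_degenerate_subgraph:
  "strictly_degenerate t G \<Longrightarrow> subgraph H G \<Longrightarrow> strictly_degenerate t H"
  unfolding strictly_degenerate_def using subgraph_trans by blast

text \<open>Without loops no edge fits on one vertex, so the only degree is 0, which is below
  \<open>t\<close>. The inclusion in the hypothesis also admits the empty graph, and with it empty
  colour classes.\<close>

lemma strictly_degenerate_singleton:
  assumes "t \<ge> 1" "verts G \<subseteq> {v}"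
  shows "strictly_degenerate t G"
  unfolding strictly_degenerate_def
proof (intro allI impI)
  fix H :: "('a, 'b) mgraph"
  assume H: "subgraph H G \<and> verts H \<noteq> {}"
  then have v: "verts H = {v}" using assms by (auto simp: subgraph_def)
  have "edges H = {}"
  proof (rule ccontr)
    assume "edges H \<noteq> {}"
    then obtain e where "e \<in> edges H" by blast
    then have "ends H e \<subseteq> {v}" "card (ends H e) = 2"
      using H v multigraph_edge[of H e] by (auto simp: subgraph_def)
    then show False using card_mono[of "{v}" "ends H e"] by simp
  qed
  then show "\<exists>v\<in>verts H. degree H v < t" using v assms by (simp add: degree_def)
qed

section \<open>Colourings and bounds for \<open>chi\<close>\<close>

text \<open>Colours may come from any type and carry no numerical bound; their number is read off as
  the size of the image. This allows sum types for disjoint palettes and \<open>unit\<close> for a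
  single colour.\<close>

definition degenerate_classes :: "nat \<Rightarrow> ('v, 'e) mgraph \<Rightarrow> ('v \<Rightarrow> 'c) \<Rightarrow> bool" where
  "degenerate_classes t G f \<longleftrightarrow>
     (\<forall>i. strictly_degenerate t (induced_subgraph G {v \<in> verts G. f v = i}))"

text \<open>Renumbering the colours that occur by an initial segment of the naturals turns
  \<open>f\<close> into a colouring as used in \<open>chi\<close>.\<close>

lemma chi_le_card_classes:
  assumes "multigraph G" "degenerate_classes t G f"
  shows "chi t G \<le> card (f ` verts G)"
proof -
  have fin: "finite (f ` verts G)" using assms by (simp add: multigraph_def)
  then obtain h where h: "bij_betw h (f ` verts G) {0..<card (f ` verts G)}"
    using ex_bij_betw_finite_nat by blast
  have "degenerate_coloring t G (card (f ` verts G)) (h \<circ> f)"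
    unfolding degenerate_coloring_def
  proof (intro conjI ballI allI impI)
    fix v assume "v \<in> verts G"
    then show "(h \<circ> f) v < card (f ` verts G)" using bij_betwE[OF h] by force
  next
    fix i assume "i < card (f ` verts G)"
    then have "i \<in> h ` f ` verts G" using h by (simp add: bij_betw_def)
    then obtain w where w: "w \<in> verts G" "i = h (f w)" by blast
    have "{v \<in> verts G. (h \<circ> f) v = i} = {v \<in> verts G. f v = f w}"
      using w h by (auto simp: bij_betw_def inj_on_def)
    then show "strictly_degenerate t (induced_subgraph G {v \<in> verts G. (h \<circ> f) v = i})"
      using assms by (simp add: degenerate_classes_def)
  qed
  then show ?thesis unfolding chi_def by (blast intro: Least_le)
qed

text \<open>Giving every vertex its own colour shows that some colouring exists, so the least number
  in \<open>chi\<close> is attained. An optimal colouring uses at most \<open>chi t G\<close>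
  colours by its range, and at least that many by minimality.\<close>

lemma ex_degenerate_classes:
  assumes "t \<ge> 1" "multigraph G"
  obtains f :: "'v \<Rightarrow> nat" where "degenerate_classes t (G :: ('v, 'e) mgraph) f"
    "card (f ` verts G) = chi t G"
proof -
  have ex: "\<exists>k c. degenerate_coloring t G k c"
  proof -
    obtain h where h: "bij_betw h (verts G) {0..<card (verts G)}"
      using assms(2) ex_bij_betw_finite_nat unfolding multigraph_def by blast
    have "strictly_degenerate t (induced_subgraph G {v \<in> verts G. h v = i})" for i
    proof (rule strictly_degenerate_singleton[OF assms(1)])
      show "verts (induced_subgraph G {v \<in> verts G. h v = i}) \<subseteq> {inv_into (verts G) h i}"
        using h by (auto simp: bij_betw_def)
    qed
    then have "degenerate_coloring t G (card (verts G)) h"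
      using bij_betwE[OF h] by (auto simp: degenerate_coloring_def)
    then show ?thesis by blast
  qed
  then obtain c where c: "degenerate_coloring t G (chi t G) c"
    unfolding chi_def using LeastI_ex[OF ex] by blast
  have "degenerate_classes t G c"
    unfolding degenerate_classes_def
  proof
    fix i
    show "strictly_degenerate t (induced_subgraph G {v \<in> verts G. c v = i})"
    proof (cases "i < chi t G")
      case True
      then show ?thesis using c by (simp add: degenerate_coloring_def)
    next
      case False
      then have "{v \<in> verts G. c v = i} = {}" using c by (auto simp: degenerate_coloring_def)
      \<comment> \<open>The class is empty, so any vertex name can play the role of the single
        vertex.\<close>
      then have "verts (induced_subgraph G {v \<in> verts G. c v = i}) \<subseteq> {undefined}" by auto
      then show ?thesis by (rule strictly_degenerate_singleton[OF assms(1)])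
    qed
  qed
  moreover have "card (c ` verts G) \<le> chi t G"
    using c card_mono[of "{..<chi t G}" "c ` verts G"] by (auto simp: degenerate_coloring_def)
  ultimately show thesis
    using that chi_le_card_classes[OF assms(2)] by (metis le_antisym)
qed

lemma degenerate_classes_subgraph:
  assumes "degenerate_classes t G f" "subgraph H G"
  shows "degenerate_classes t H f"
  unfolding degenerate_classes_def
proof
  fix i
  have "subgraph (induced_subgraph H {v \<in> verts H. f v = i})
      (induced_subgraph G {v \<in> verts G. f v = i})"
    using assms(2) by (intro induced_subgraph_mono) (auto simp: subgraph_def)
  then show "strictly_degenerate t (induced_subgraph H {v \<in> verts H. f v = i})"
    using assms(1) strictly_degenerate_subgraph unfolding degenerate_classes_def by blast
qed

lemma chi_mono:
  assumes "t \<ge> 1" "multigraph G" "subgraph H G"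
  shows "chi t H \<le> chi t G"
proof -
  obtain f :: "_ \<Rightarrow> nat" where f: "degenerate_classes t G f" "card (f ` verts G) = chi t G"
    using ex_degenerate_classes[OF assms(1,2)] .
  have "chi t H \<le> card (f ` verts H)"
    using assms(3) f(1) by (meson chi_le_card_classes degenerate_classes_subgraph subgraph_multigraph)
  also have "\<dots> \<le> card (f ` verts G)"
    using assms by (intro card_mono) (auto simp: subgraph_def multigraph_def)
  finally show ?thesis using f(2) by simp
qed

lemma chi_le_one:
  assumes "multigraph G" "strictly_degenerate t G"
  shows "chi t G \<le> 1"
proof -
  \<comment> \<open>With \<open>unit\<close> as palette the only class is the whole vertex set,
    which induces \<open>G\<close> itself.\<close>
  have "degenerate_classes t G (\<lambda>_. ())"
    using assms by (simp add: degenerate_classes_def induced_subgraph_verts)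
  then have "chi t G \<le> card ((\<lambda>_. ()) ` verts G)" using assms chi_le_card_classes by blast
  also have "\<dots> \<le> card {()}" by (rule card_mono) auto
  finally show ?thesis by simp
qed

text \<open>Optimal colourings of the two parts with disjoint palettes combine into one of the
  union. The sets may overlap: common vertices keep their colour from \<open>X\<close>, and classes
  on the \<open>Y\<close> side only shrink.\<close>

lemma chi_induced_Un_le:
  assumes t: "t \<ge> 1" and G: "multigraph G" and XY: "X \<union> Y \<subseteq> verts G"
  shows "chi t (induced_subgraph G (X \<union> Y)) \<le>
    chi t (induced_subgraph G X) + chi t (induced_subgraph G Y)"
proof -
  let ?U = "induced_subgraph G (X \<union> Y)"
  have mX: "multigraph (induced_subgraph G X)" and mY: "multigraph (induced_subgraph G Y)"
    and mU: "multigraph ?U"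
    using G XY by (auto intro: multigraph_induced)
  have fin: "finite X" "finite Y" using mX mY by (auto simp: multigraph_def)
  obtain f :: "_ \<Rightarrow> nat" where f: "degenerate_classes t (induced_subgraph G X) f"
      "card (f ` X) = chi t (induced_subgraph G X)"
    using ex_degenerate_classes[OF t mX] by auto
  obtain g :: "_ \<Rightarrow> nat" where g: "degenerate_classes t (induced_subgraph G Y) g"
      "card (g ` Y) = chi t (induced_subgraph G Y)"
    using ex_degenerate_classes[OF t mY] by auto
  \<comment> \<open>The tags \<open>Inl\<close> and \<open>Inr\<close> keep the palettes apart, so
    each class of \<open>h\<close> lies inside one class of \<open>f\<close> or of
    \<open>g\<close>.\<close>
  define h where "h v = (if v \<in> X then Inl (f v) else Inr (g v))" for v
  have "strictly_degenerate t (induced_subgraph ?U {v \<in> verts ?U. h v = i})" for i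
  proof (cases i)
    case (Inl j)
    have "subgraph (induced_subgraph ?U {v \<in> verts ?U. h v = i})
        (induced_subgraph (induced_subgraph G X) {v \<in> X. f v = j})"
      using G XY mU Inl
      by (intro subgraph_inducedI subgraph_trans[OF subgraph_induced] subgraph_induced)
        (auto simp: h_def intro: multigraph_induced split: if_splits)
    then show ?thesis
      using f(1) strictly_degenerate_subgraph by (force simp: degenerate_classes_def)
  next
    case (Inr j)
    have "subgraph (induced_subgraph ?U {v \<in> verts ?U. h v = i})
        (induced_subgraph (induced_subgraph G Y) {v \<in> Y. g v = j})"
      using G XY mU Inr
      by (intro subgraph_inducedI subgraph_trans[OF subgraph_induced] subgraph_induced)
        (auto simp: h_def intro: multigraph_induced split: if_splits)
    then show ?thesis
      using g(1) strictly_degenerate_subgraph by (force simp: degenerate_classes_def)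
  qed
  then have "chi t ?U \<le> card (h ` (X \<union> Y))"
    using chi_le_card_classes[OF mU, of t h] by (simp add: degenerate_classes_def)
  also have "\<dots> \<le> card (f ` X <+> g ` Y)"
    using fin by (intro card_mono) (auto simp: h_def)
  also have "\<dots> = card (f ` X) + card (g ` Y)"
    using fin by (simp add: card_Plus)
  finally show ?thesis using f(2) g(2) by simp
qed

section \<open>Joined vertices and the lower bound\<close>

text \<open>The subgraph formed by \<open>u\<close>, \<open>v\<close> and all edges between them has
  no vertex of degree below \<open>t\<close>.\<close>

lemma not_strictly_degenerate_if_joined:
  assumes G: "multigraph G" and uv: "u \<in> verts G" "v \<in> verts G"
    and t: "t \<le> card (edges_between G u v)"
  shows "\<not> strictly_degenerate t G"
proof
  assume deg: "strictly_degenerate t G"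
  define H where "H = \<lparr>verts = {u, v}, edges = edges_between G u v, ends = ends G\<rparr>"
  have "subgraph H G"
    using G uv by (auto simp: subgraph_def H_def edges_between_def multigraph_def)
  then obtain w where "w \<in> {u, v}" "degree H w < t"
    using deg by (auto simp: strictly_degenerate_def H_def)
  moreover from this have "{e \<in> edges H. w \<in> ends H e} = edges_between G u v"
    by (auto simp: H_def edges_between_def)
  ultimately show False using t by (simp add: degree_def)
qed

text \<open>An optimal colouring of \<open>G\<close> uses disjoint colour sets on \<open>A\<close>
  and \<open>B\<close>, since a shared colour would put a joined pair into one class. Stated for
  subgraphs of an arbitrary \<open>G\<close>, it serves both the join itself and the subgraphs of it
  that arise in the criticality argument.\<close>

lemma chi_join_ge:
  assumes t: "t \<ge> 1" and G: "multigraph G" and A: "subgraph A G" and B: "subgraph B G"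
    and join: "\<And>u v. u \<in> verts A \<Longrightarrow> v \<in> verts B \<Longrightarrow> t \<le> card (edges_between G u v)"
  shows "chi t A + chi t B \<le> chi t G"
proof -
  obtain f :: "_ \<Rightarrow> nat" where f: "degenerate_classes t G f" "card (f ` verts G) = chi t G"
    using ex_degenerate_classes[OF t G] .
  have sub: "verts A \<subseteq> verts G" "verts B \<subseteq> verts G" using A B by (auto simp: subgraph_def)
  have fin: "finite (verts G)" using G by (simp add: multigraph_def)
  have "f u \<noteq> f v" if uv: "u \<in> verts A" "v \<in> verts B" for u v
  proof
    assume eq: "f u = f v"
    let ?I = "induced_subgraph G {x \<in> verts G. f x = f v}"
    \<comment> \<open>Both ends lie in the class, so all their parallel edges survive in the induced
      subgraph.\<close>
    have "edges_between ?I u v = edges_between G u v"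
      using uv sub eq by (auto simp: edges_between_def)
    then have "\<not> strictly_degenerate t ?I"
      using uv sub eq join[OF uv] G
      by (intro not_strictly_degenerate_if_joined[of _ u v] multigraph_induced) auto
    then show False using f(1) by (simp add: degenerate_classes_def)
  qed
  then have "f ` verts A \<inter> f ` verts B = {}" by blast
  then have "card (f ` verts A) + card (f ` verts B) = card (f ` (verts A \<union> verts B))"
    using fin sub finite_subset by (subst image_Un, subst card_Un_disjoint) (auto intro: finite_subset)
  also have "\<dots> \<le> card (f ` verts G)"
    using fin sub by (intro card_mono) auto
  finally have "card (f ` verts A) + card (f ` verts B) \<le> chi t G" using f(2) by simp
  moreover have "chi t A \<le> card (f ` verts A)" "chi t B \<le> card (f ` verts B)"
    using f(1) A B
    by (meson chi_le_card_classes degenerate_classes_subgraph subgraph_multigraph)+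
  ultimately show ?thesis by linarith
qed

section \<open>Dirac joins and additivity of \<open>chi\<close>\<close>

text \<open>This symmetry transfers results about the left side of a join to the right side.\<close>

lemma dirac_join_commute:
  assumes "dirac_join t G1 G2 G"
  shows "dirac_join t G2 G1 G"
proof -
  have "edges_between G u v = edges_between G v u" for u v
    by (simp add: edges_between_def insert_commute)
  then have "\<forall>v\<in>verts G2. \<forall>u\<in>verts G1. card (edges_between G v u) = t"
    using assms unfolding dirac_join_def by metis
  moreover have "\<exists>v\<in>verts G2. \<exists>u\<in>verts G1. ends G e = {v, u}"
    if "e \<in> edges G - (edges G2 \<union> edges G1)" for e
  proof -
    have "e \<in> edges G - (edges G1 \<union> edges G2)" using that by blast
    then obtain u v where "u \<in> verts G1" "v \<in> verts G2" "ends G e = {u, v}"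
      using assms unfolding dirac_join_def by meson
    then show ?thesis by (auto simp: insert_commute)
  qed
  ultimately show ?thesis
    using assms unfolding dirac_join_def by (simp add: Un_commute)
qed

text \<open>Every edge of \<open>G2\<close> and every joining edge has an end in \<open>G2\<close>,
  hence none of them lies within \<open>X\<close>. What \<open>H\<close> induces on \<open>X\<close>
  therefore consists of edges of \<open>G1\<close> only.\<close>

lemma induced_in_left:
  assumes J: "dirac_join t G1 G2 G" and disj: "disjoint_graphs G1 G2" and "multigraph G2"
    and H: "subgraph H G" and X: "X \<subseteq> verts H" "X \<subseteq> verts G1"
  shows "subgraph (induced_subgraph H X) G1"
proof -
  have "e \<in> edges G1 \<and> ends H e = ends G1 e" if e: "e \<in> edges H" "ends H e \<subseteq> X" for e
  proof -
    have eG: "e \<in> edges G" "ends H e = ends G e" using e H by (auto simp: subgraph_def)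
    have d: "verts G1 \<inter> verts G2 = {}" using disj by (simp add: disjoint_graphs_def)
    have "card (ends H e) = 2" using multigraph_edge(2)[OF subgraph_multigraph[OF H] e(1)] .
    then have ne: "ends H e \<noteq> {}" by auto
    have "e \<notin> edges G2"
    proof
      assume "e \<in> edges G2"
      then have "ends G e \<subseteq> verts G2"
        using J multigraph_edge(1)[OF assms(3), of e] by (simp add: dirac_join_def subgraph_def)
      then show False using ne d X e eG by blast
    qed
    moreover have "e \<in> edges G1 \<union> edges G2"
    proof (rule ccontr)
      assume "e \<notin> edges G1 \<union> edges G2"
      then obtain u v where "v \<in> verts G2" "ends G e = {u, v}"
        using J eG(1) unfolding dirac_join_def by (meson DiffI)
      then show False using e eG d X by auto
    qed
    ultimately have "e \<in> edges G1" by simp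
    then show ?thesis using J eG by (simp add: dirac_join_def subgraph_def)
  qed
  then show ?thesis
    using X H multigraph_induced[of H X] subgraph_multigraph[of H G]
    by (auto simp: subgraph_def)
qed

text \<open>Colouring the sides with disjoint palettes gives the upper bound;
  \<open>chi_join_ge\<close> gives the lower one.\<close>

lemma chi_dirac_join:
  assumes t: "t \<ge> 1" and G1: "multigraph G1" and G2: "multigraph G2"
    and disj: "disjoint_graphs G1 G2" and J: "dirac_join t G1 G2 G"
  shows "chi t G = chi t G1 + chi t G2"
proof (rule antisym)
  have G: "multigraph G" and V: "verts G = verts G1 \<union> verts G2"
    using J by (auto simp: dirac_join_def)
  have GG: "subgraph G G" using G by (simp add: subgraph_def)
  have "subgraph (induced_subgraph G (verts G1)) G1"
    using induced_in_left[OF J disj G2 GG] V by simp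
  moreover have "subgraph (induced_subgraph G (verts G2)) G2"
    using induced_in_left[OF dirac_join_commute[OF J] _ G1 GG] V disj
    by (simp add: disjoint_graphs_def Int_commute)
  moreover have "chi t G \<le> chi t (induced_subgraph G (verts G1)) + chi t (induced_subgraph G (verts G2))"
    using chi_induced_Un_le[OF t G, of "verts G1" "verts G2"] induced_subgraph_verts[OF G] V by simp
  ultimately show "chi t G \<le> chi t G1 + chi t G2"
    using chi_mono[OF t] G1 G2 by (meson add_mono order_trans)
  show "chi t G1 + chi t G2 \<le> chi t G"
    using J by (intro chi_join_ge[OF t G]) (auto simp: dirac_join_def)
qed

section \<open>Criticality of joins\<close>

text \<open>Replacing \<open>G1\<close> by a proper subgraph \<open>H1\<close> inside the join gives
  a proper subgraph \<open>H\<close> of \<open>G\<close> in which \<open>H1\<close> and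
  \<open>G2\<close> are still fully joined. So
  \<open>chi t H1 + chi t G2 \<le> chi t H < chi t G\<close>, and \<open>chi t G2\<close> cancels by
  additivity.\<close>

lemma chi_critical_left:
  assumes t: "t \<ge> 1" and G1: "multigraph G1" and G2: "multigraph G2"
    and disj: "disjoint_graphs G1 G2" and J: "dirac_join t G1 G2 G"
    and crit: "chi_critical t G"
  shows "chi_critical t G1"
  unfolding chi_critical_def
proof (intro allI impI)
  fix H1 :: "('a, 'b) mgraph" assume P: "proper_subgraph H1 G1"
  have G: "multigraph G" and S1: "subgraph G1 G" and S2: "subgraph G2 G"
    and V: "verts G = verts G1 \<union> verts G2" using J by (auto simp: dirac_join_def)
  have H1: "subgraph H1 G1" using P by (simp add: proper_subgraph_def)
  have d: "verts G1 \<inter> verts G2 = {}" "edges G1 \<inter> edges G2 = {}"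
    using disj by (auto simp: disjoint_graphs_def)
  \<comment> \<open>\<open>H\<close> is the join of \<open>H1\<close> and \<open>G2\<close> realised
    inside \<open>G\<close>: the vertices of \<open>G1\<close> outside \<open>H1\<close> go together
    with their edges, and so do the edges of \<open>G1\<close> that \<open>H1\<close> lacks.\<close>
  define H where "H = \<lparr>verts = verts H1 \<union> verts G2,
    edges = {e \<in> edges G. ends G e \<subseteq> verts H1 \<union> verts G2} - (edges G1 - edges H1), ends = ends G\<rparr>"
  have HG: "subgraph H G"
    using G H1 V by (auto simp: H_def subgraph_def multigraph_def intro: finite_subset)
  have "proper_subgraph H G"
  proof (cases "verts H1 = verts G1")
    case True
    then obtain e where e: "e \<in> edges G1" "e \<notin> edges H1"
      using P by (auto simp: proper_subgraph_def subgraph_def)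
    then have "e \<in> edges G" "e \<notin> edges H" using S1 by (auto simp: H_def subgraph_def)
    then show ?thesis using HG by (auto simp: proper_subgraph_def)
  next
    case False
    then have "verts H \<noteq> verts G" using H1 V d by (auto simp: H_def subgraph_def)
    then show ?thesis using HG by (simp add: proper_subgraph_def)
  qed
  then have lt: "chi t H < chi t G" using crit by (simp add: chi_critical_def)
  have H1H: "subgraph H1 H"
  proof -
    have "subgraph H1 G" using H1 S1 subgraph_trans by blast
    then show ?thesis using multigraph_edge(1)[of H1] by (fastforce simp: subgraph_def H_def)
  qed
  have G2H: "subgraph G2 H"
    using S2 d multigraph_edge(1)[OF G2] by (fastforce simp: subgraph_def H_def)
  have "t \<le> card (edges_between H u v)" if uv: "u \<in> verts H1" "v \<in> verts G2" for u v
  proof -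
    have u: "u \<in> verts G1" using uv H1 by (auto simp: subgraph_def)
    have "edges_between H u v = edges_between G u v"
    proof -
      \<comment> \<open>Only edges of \<open>G1\<close> are removed explicitly, so no edge between
        \<open>u\<close> and \<open>v\<close> is lost.\<close>
      have "e \<notin> edges G1" if "ends G e = {u, v}" for e
      proof
        assume "e \<in> edges G1"
        then have "{u, v} \<subseteq> verts G1"
          using that S1 multigraph_edge(1)[OF G1, of e] by (simp add: subgraph_def)
        then show False using d uv by auto
      qed
      then show ?thesis using uv by (auto simp: edges_between_def H_def)
    qed
    then show ?thesis using J u uv by (simp add: dirac_join_def)
  qed
  then have "chi t H1 + chi t G2 \<le> chi t H"
    using chi_join_ge[OF t _ H1H G2H] HG subgraph_multigraph by blast
  then show "chi t H1 < chi t G1"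
    using lt chi_dirac_join[OF t G1 G2 disj J] by simp
qed

text \<open>No degree exceeds the total number of edges. It applies to a joined pair that has lost
  one of its \<open>t\<close> edges.\<close>

lemma strictly_degenerate_pair:
  assumes G: "multigraph G" and V: "verts G = {u, v}" and lt: "card (edges G) < t"
  shows "strictly_degenerate t G"
  unfolding strictly_degenerate_def
proof (intro allI impI)
  fix H :: "('a, 'b) mgraph" assume H: "subgraph H G \<and> verts H \<noteq> {}"
  then obtain w where w: "w \<in> verts H" by blast
  have "degree H w \<le> card (edges G)"
    unfolding degree_def using H G by (intro card_mono) (auto simp: subgraph_def multigraph_def)
  then show "\<exists>v\<in>verts H. degree H v < t" using w lt by (intro bexI[of _ w]) auto
qed

lemma chi_delete_vertex_less:
  assumes "chi_critical t G" "v \<in> verts G" "subgraph H G" "v \<notin> verts H"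
  shows "chi t H < chi t G"
proof -
  have "proper_subgraph H G" using assms(2-4) by (auto simp: proper_subgraph_def)
  then show ?thesis using assms(1) by (simp add: chi_critical_def)
qed

text \<open>\<open>H\<close> is split into its parts on the two sides. If one part is proper, its
  \<open>chi\<close> drops and subadditivity suffices. Otherwise \<open>H\<close> contains both
  sides and lacks some joining edge, whose ends can share a colour.\<close>

lemma chi_critical_join:
  assumes t: "t \<ge> 1" and G1: "multigraph G1" and G2: "multigraph G2"
    and disj: "disjoint_graphs G1 G2" and J: "dirac_join t G1 G2 G"
    and crit: "chi_critical t G1" "chi_critical t G2"
  shows "chi_critical t G"
  unfolding chi_critical_def
proof (intro allI impI)
  fix H :: "('a, 'b) mgraph" assume P: "proper_subgraph H G"
  have G: "multigraph G" and S1: "subgraph G1 G" and S2: "subgraph G2 G"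
    and V: "verts G = verts G1 \<union> verts G2" using J by (auto simp: dirac_join_def)
  have HG: "subgraph H G" using P by (simp add: proper_subgraph_def)
  have H: "multigraph H" using HG by (rule subgraph_multigraph)
  have disj': "disjoint_graphs G2 G1" using disj by (auto simp: disjoint_graphs_def)
  have chiG: "chi t G = chi t G1 + chi t G2" by (rule chi_dirac_join[OF t G1 G2 disj J])
  note left = induced_in_left[OF J disj G2 HG]
  note right = induced_in_left[OF dirac_join_commute[OF J] disj' G1 HG]
  let ?H1 = "induced_subgraph H (verts H \<inter> verts G1)"
  let ?H2 = "induced_subgraph H (verts H \<inter> verts G2)"
  have H1: "subgraph ?H1 G1" and H2: "subgraph ?H2 G2" by (auto intro: left right)
  have VH: "verts H \<inter> verts G1 \<union> verts H \<inter> verts G2 = verts H"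
    using HG V by (auto simp: subgraph_def)
  have le: "chi t H \<le> chi t ?H1 + chi t ?H2"
    using chi_induced_Un_le[OF t H, of "verts H \<inter> verts G1" "verts H \<inter> verts G2"]
    by (simp add: VH induced_subgraph_verts[OF H])
  consider "proper_subgraph ?H1 G1" | "proper_subgraph ?H2 G2"
    | "\<not> proper_subgraph ?H1 G1" "\<not> proper_subgraph ?H2 G2" by blast
  then show "chi t H < chi t G"
  proof cases
    case 1
    then have "chi t ?H1 < chi t G1" using crit by (simp add: chi_critical_def)
    then show ?thesis using le chiG chi_mono[OF t G2 H2] by simp
  next
    case 2
    then have "chi t ?H2 < chi t G2" using crit by (simp add: chi_critical_def)
    then show ?thesis using le chiG chi_mono[OF t G1 H1] by simp
  next
    case 3
    then have eq: "verts ?H1 = verts G1" "edges ?H1 = edges G1"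
        "verts ?H2 = verts G2" "edges ?H2 = edges G2"
      using H1 H2 by (auto simp only: proper_subgraph_def)
    then have VG: "verts H = verts G" and E: "edges G1 \<union> edges G2 \<subseteq> edges H"
      using VH V by (simp_all, blast)
    \<comment> \<open>No vertex is missing, so properness of \<open>H\<close> must come from an
      edge; as both sides are complete, it is a joining edge.\<close>
    then obtain e where e: "e \<in> edges G" "e \<notin> edges H"
      using P by (auto simp: proper_subgraph_def subgraph_def)
    then have "e \<in> edges G - (edges G1 \<union> edges G2)" using E by blast
    then obtain u v where uv: "u \<in> verts G1" "v \<in> verts G2" "ends G e = {u, v}"
      using J unfolding dirac_join_def by meson
    let ?A = "verts G1 - {u}" and ?B = "verts G2 - {v}"
    have A: "chi t (induced_subgraph H ?A) < chi t G1"
      using left[of ?A] VG V by (intro chi_delete_vertex_less[OF crit(1) uv(1)]) auto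
    have B: "chi t (induced_subgraph H ?B) < chi t G2"
      using right[of ?B] VG V by (intro chi_delete_vertex_less[OF crit(2) uv(2)]) auto
    have C: "chi t (induced_subgraph H {u, v}) \<le> 1"
    proof (rule chi_le_one)
      show m: "multigraph (induced_subgraph H {u, v})"
        using H uv VG V by (intro multigraph_induced) auto
      have sub: "edges (induced_subgraph H {u, v}) \<subseteq> edges_between G u v"
      proof
        fix x assume x: "x \<in> edges (induced_subgraph H {u, v})"
        then have xH: "x \<in> edges H" "ends H x \<subseteq> {u, v}" by auto
        have "card (ends H x) = 2" using multigraph_edge(2)[OF H xH(1)] .
        moreover have "card {u, v} \<le> 2" by (simp add: card_insert_if)
        \<comment> \<open>A two-element set inside \<open>{u, v}\<close> is all of it, so every
          induced edge is parallel to \<open>e\<close>.\<close>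
        ultimately have "ends H x = {u, v}"
          using xH(2) by (intro card_seteq) auto
        then show "x \<in> edges_between G u v"
          using xH(1) HG by (auto simp: edges_between_def subgraph_def)
      qed
      \<comment> \<open>Since \<open>e\<close> is absent from \<open>H\<close>, fewer than
        \<open>t\<close> of the \<open>t\<close> parallel edges remain.\<close>
      have "e \<in> edges_between G u v" using e uv by (simp add: edges_between_def)
      then have "edges (induced_subgraph H {u, v}) \<subset> edges_between G u v"
        using sub e by auto
      moreover have "finite (edges_between G u v)"
        using G by (simp add: edges_between_def multigraph_def)
      ultimately have "card (edges (induced_subgraph H {u, v})) < card (edges_between G u v)"
        using psubset_card_mono by blast
      then show "strictly_degenerate t (induced_subgraph H {u, v})"
        using J uv by (intro strictly_degenerate_pair[OF m]) (auto simp: dirac_join_def)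
    qed
    \<comment> \<open>The three-part cover saves one colour on each side and spends at most one on
      the pair, a net gain of at least one.\<close>
    have all: "?A \<union> (?B \<union> {u, v}) = verts H" using uv VG V by auto
    have "chi t H \<le> chi t (induced_subgraph H ?A) + chi t (induced_subgraph H (?B \<union> {u, v}))"
      using chi_induced_Un_le[OF t H, of ?A "?B \<union> {u, v}"]
      by (simp only: all induced_subgraph_verts[OF H])
    also have "chi t (induced_subgraph H (?B \<union> {u, v})) \<le>
        chi t (induced_subgraph H ?B) + chi t (induced_subgraph H {u, v})"
      using all by (intro chi_induced_Un_le[OF t H]) blast
    finally show ?thesis using A B C chiG by simp
  qed
qed

theorem theorem11:
  fixes t :: nat and G1 G2 G :: "('v, 'e) mgraph"
  assumes "t \<ge> 1"
    and "multigraph G1" and "multigraph G2"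
    and "verts G1 \<noteq> {}" and "verts G2 \<noteq> {}"
    and "disjoint_graphs G1 G2"
    and "dirac_join t G1 G2 G"
  shows "chi t G = chi t G1 + chi t G2 \<and>
    (chi_critical t G \<longleftrightarrow> chi_critical t G1 \<and> chi_critical t G2)"
proof -
  have J: "dirac_join t G2 G1 G" using assms(7) by (rule dirac_join_commute)
  have d: "disjoint_graphs G2 G1" using assms(6) by (auto simp: disjoint_graphs_def)
  show ?thesis
    using chi_dirac_join[OF assms(1-3,6,7)] chi_critical_left[OF assms(1-3,6,7)]
      chi_critical_left[OF assms(1,3,2) d J] chi_critical_join[OF assms(1-3,6,7)]
    by blast
qed

end
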